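(* Let $\Lambda=\{\lambda_1,\lambda_2,\ldots,\lambda_n\}$ be a list of real numbers. Suppose that: (i) There exists a partition (as multisets) $\Lambda=\Lambda_0\cup\underbrace{\Lambda_1\cup\cdots\cup\Lambda_1}_{r\text{ times}}$, where $$\Lambda_0=\{\lambda_{01},\lambda_{02},\ldots,\lambda_{0r}\},\qquad \Lambda_1=\{\lambda_{11},\lambda_{12},\ldots,\lambda_{1p}\},$$ and a real number $\lambda$ with $0\le\lambda\le\lambda_1$ such that $\Gamma_1=\{\lambda,\lambda_{11},\lambda_{12},\ldots,\lambda_{1p}\}$ is the spectrum of a $(p+1)\times(p+1)$ permutative nonnegative matrix whose Perron eigenvalue is $\lambda$. (ii) There exists an $r\times r$ permutative nonnegative matrix with spectrum $\Lambda_0$ and all $r$ diagonal entries equal to $\lambda$. Then there exists a permutative nonnegative matrix $P$ with spectrum $\Lambda$.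
   Context: Lists are multisets, and the spectrum of a matrix is the list of its eigenvalues counted with algebraic multiplicity. An $n\times n$ matrix is permutative if every one of its rows is a permutation of its first row. Nonnegative is meant entrywise. The Perron eigenvalue of a nonnegative matrix is its spectral radius (which is an eigenvalue). *)

theory Defs
  imports
    "Jordan_Normal_Form.Spectral_Radius"
    "HOL-Computational_Algebra.Polynomial"
    "HOL-Library.Multiset"
begin

definition permutative_mat :: "'a mat \<Rightarrow> bool" where
  "permutative_mat A \<longleftrightarrow> square_mat A \<and>
     (\<forall>i < dim_row A. mset (list_of_vec (row A i)) = mset (list_of_vec (row A 0)))"

definition nonnegative_mat :: "real mat \<Rightarrow> bool" where
  "nonnegative_mat A \<longleftrightarrow> (\<forall>i < dim_row A. \<forall>j < dim_col A. 0 \<le> A $$ (i, j))"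

abbreviation complex_mat :: "real mat \<Rightarrow> complex mat" where
  "complex_mat A \<equiv> map_mat complex_of_real A"

text \<open>The constant \<open>spectrum\<close> of Jordan_Normal_Form is the set of eigenvalues; here the
  complex eigenvalues are collected with their algebraic multiplicities, i.e. their
  multiplicities as roots of the characteristic polynomial.\<close>

definition spectrum_mset :: "real mat \<Rightarrow> complex multiset" where
  "spectrum_mset A = proots (char_poly (complex_mat A))"

definition has_spectrum :: "real mat \<Rightarrow> real list \<Rightarrow> bool" where
  "has_spectrum A xs \<longleftrightarrow> spectrum_mset A = image_mset complex_of_real (mset xs)"

definition perron_eigenvalue :: "real mat \<Rightarrow> real" where
  "perron_eigenvalue A = spectral_radius (complex_mat A)"

end

theory Submission
  imports Defs
begin

text \<open>Write \<open>m = p + 1\<close>, let \<open>B\<close> and \<open>A\<close> be the matrices of (i) and (ii), and let \<open>C\<close> be the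
  \<open>m \<times> m\<close> matrix with ones in column \<open>0\<close> and zeros elsewhere. Take
  \<open>P = I \<otimes> B + (A - \<lambda> I) \<otimes> C\<close>: the diagonal blocks are \<open>B\<close>, because \<open>A\<close> has diagonal \<open>\<lambda>\<close>, and the
  \<open>(i, j)\<close> block off the diagonal is \<open>a\<^sub>i\<^sub>j C\<close>. A row of \<open>P\<close> thus consists of a row of \<open>B\<close>, the
  off-diagonal part of a row of \<open>A\<close> and zeros, so \<open>P\<close> is permutative and nonnegative.

  The rows of \<open>B\<close> sum to its Perron eigenvalue \<open>\<lambda>\<close>, so \<open>B\<close> can be triangularized by some \<open>T\<close> whose
  first column is the all-ones vector; \<open>T\<^sup>-\<^sup>1 C T\<close> then vanishes below row \<open>0\<close> and has \<open>(0, 0)\<close> entry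
  \<open>1\<close>. If \<open>R\<close> triangularizes \<open>A\<close>, then \<open>R \<otimes> T\<close> triangularizes \<open>P\<close>, and on the diagonal each of the
  \<open>r\<close> copies of \<open>\<lambda>\<close> in \<open>I \<otimes> B\<close> is replaced by an eigenvalue of \<open>A\<close>.\<close>

section \<open>Sums over product index ranges, and multisets written as sums of singletons\<close>

lemma sum_lessThan_mult:
  fixes f :: "nat \<Rightarrow> nat \<Rightarrow> 'a::comm_monoid_add"
  shows "(\<Sum>k<a*b. f (k div b) (k mod b)) = (\<Sum>i<a. \<Sum>j<b. f i j)"
proof -
  have "(\<Sum>k<a*b. f (k div b) (k mod b)) = (\<Sum>i<a. \<Sum>k = i*b..<i*b+b. f (k div b) (k mod b))"
    by (rule sum.nat_group[symmetric])
  also have "\<dots> = (\<Sum>i<a. \<Sum>j<b. f i j)"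
  proof (rule sum.cong[OF refl])
    fix i
    have "k div b = i" "k mod b = k - i * b" if "k \<in> {i*b..<i*b+b}" for k
    proof -
      from that obtain j where "k = i * b + j" "j < b" by (auto dest!: le_Suc_ex)
      then show "k div b = i" "k mod b = k - i * b" by auto
    qed
    then show "(\<Sum>k = i*b..<i*b+b. f (k div b) (k mod b)) = (\<Sum>j<b. f i j)"
      by (intro sum.reindex_bij_witness[of _ "\<lambda>j. i*b+j" "\<lambda>k. k - i*b"]) auto
  qed
  finally show ?thesis .
qed

lemma mset_map_upt: "mset (map f [0..<n]) = (\<Sum>k<n. {#f k#})"
  by (induction n) auto

lemma mset_list_of_vec: "mset (list_of_vec v) = (\<Sum>k<dim_vec v. {#v $ k#})"
proof -
  have "list_of_vec v = map (($) v) [0..<dim_vec v]"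
    by (rule nth_equalityI) (auto simp: list_of_vec_index)
  then show ?thesis by (simp only: mset_map_upt)
qed

lemma mset_diag_mat: "mset (diag_mat A) = (\<Sum>k<dim_row A. {#A $$ (k, k)#})"
  unfolding diag_mat_def by (rule mset_map_upt)

text \<open>Applying \<open>sum_mset\<close> to both multisets recovers the sums. This is how rows
  that are permutations of each other get equal row sums.\<close>

lemma sum_singleton_eq_sum:
  fixes f g :: "nat \<Rightarrow> 'a::comm_monoid_add"
  assumes "(\<Sum>k<n. {#f k#}) = (\<Sum>k<m. {#g k#})"
  shows "(\<Sum>k<n. f k) = (\<Sum>k<m. g k)"
proof -
  have *: "sum_mset (\<Sum>k<n. {#f k#}) = (\<Sum>k<n. f k)" for f :: "nat \<Rightarrow> 'a" and n :: nat
    by (induction n) (auto simp: add.commute)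
  show ?thesis using arg_cong[OF assms, of sum_mset] by (simp only: *)
qed

section \<open>Kronecker products\<close>

definition kron :: "'a::semiring_1 mat \<Rightarrow> 'a mat \<Rightarrow> 'a mat" where
  "kron A B = mat (dim_row A * dim_row B) (dim_col A * dim_col B)
     (\<lambda>(i, j). A $$ (i div dim_row B, j div dim_col B) * B $$ (i mod dim_row B, j mod dim_col B))"

lemma kron_carrier [intro, simp]:
  assumes "A \<in> carrier_mat a b" "B \<in> carrier_mat c d"
  shows "kron A B \<in> carrier_mat (a * c) (b * d)"
  using assms unfolding kron_def by auto

lemma div_mod_less:
  fixes i :: nat
  assumes "i < a * b"
  shows "i div b < a" "i mod b < b"
  using assms by (cases "b = 0"; auto simp: less_mult_imp_div_less)+

lemma index_kron:
  assumes "A \<in> carrier_mat a b" "B \<in> carrier_mat c d" "i < a * c" "j < b * d"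
  shows "kron A B $$ (i, j) = A $$ (i div c, j div d) * B $$ (i mod c, j mod d)"
  using assms unfolding kron_def by auto

lemma kron_one: "kron (1\<^sub>m a) (1\<^sub>m b) = 1\<^sub>m (a * b)"
proof (rule eq_matI)
  fix i j assume "i < dim_row (1\<^sub>m (a * b) :: 'a mat)" "j < dim_col (1\<^sub>m (a * b) :: 'a mat)"
  then have ij: "i < a * b" "j < a * b" by auto
  have "i = j \<longleftrightarrow> i div b = j div b \<and> i mod b = j mod b"
    by (metis div_mult_mod_eq)
  then show "kron (1\<^sub>m a) (1\<^sub>m b) $$ (i, j) = (1\<^sub>m (a * b) :: 'a mat) $$ (i, j)"
    using ij div_mod_less[OF ij(1)] div_mod_less[OF ij(2)]
    by (auto simp: index_kron[OF one_carrier_mat one_carrier_mat])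
qed (auto simp: kron_def)

text \<open>The mixed-product rule. The summation index splits into its quotient and remainder by
  \<open>e\<close>, and the resulting double sum factors by distributivity; commutativity is what
  lets the inner entries of \<open>B\<close> and \<open>C\<close> change places.\<close>

lemma kron_mult:
  fixes A :: "'a::comm_semiring_1 mat"
  assumes A: "A \<in> carrier_mat a b" and C: "C \<in> carrier_mat b c"
    and B: "B \<in> carrier_mat d e" and D: "D \<in> carrier_mat e f"
  shows "kron A B * kron C D = kron (A * C) (B * D)"
proof (rule eq_matI)
  have K: "kron A B \<in> carrier_mat (a * d) (b * e)" "kron C D \<in> carrier_mat (b * e) (c * f)"
    "kron (A * C) (B * D) \<in> carrier_mat (a * d) (c * f)"
    "A * C \<in> carrier_mat a c" "B * D \<in> carrier_mat d f"
    using assms by auto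
  fix i j assume "i < dim_row (kron (A * C) (B * D))" "j < dim_col (kron (A * C) (B * D))"
  then have ij: "i < a * d" "j < c * f" using K by auto
  note l = div_mod_less[OF ij(1)] div_mod_less[OF ij(2)]
  have "(kron A B * kron C D) $$ (i, j) = (\<Sum>k<b*e. kron A B $$ (i, k) * kron C D $$ (k, j))"
    using K ij by (auto simp: scalar_prod_def atLeast0LessThan)
  also have "\<dots> = (\<Sum>k<b*e. A $$ (i div d, k div e) * B $$ (i mod d, k mod e)
      * (C $$ (k div e, j div f) * D $$ (k mod e, j mod f)))"
    by (rule sum.cong) (auto simp: index_kron[OF A B] index_kron[OF C D] ij)
  also have "\<dots> = (\<Sum>x<b. \<Sum>y<e. A $$ (i div d, x) * B $$ (i mod d, y)
      * (C $$ (x, j div f) * D $$ (y, j mod f)))"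
    by (rule sum_lessThan_mult)
  also have "\<dots> = (\<Sum>x<b. A $$ (i div d, x) * C $$ (x, j div f)) *
      (\<Sum>y<e. B $$ (i mod d, y) * D $$ (y, j mod f))"
    unfolding sum_product by (intro sum.cong refl) (simp add: ac_simps)
  also have "\<dots> = (A * C) $$ (i div d, j div f) * (B * D) $$ (i mod d, j mod f)"
    using assms l by (simp add: scalar_prod_def atLeast0LessThan)
  also have "\<dots> = kron (A * C) (B * D) $$ (i, j)"
    using index_kron[OF K(4,5) ij] by simp
  finally show "(kron A B * kron C D) $$ (i, j) = kron (A * C) (B * D) $$ (i, j)" .
qed (use assms in \<open>auto simp: kron_def\<close>)

section \<open>Triangularization and spectra with multiplicity\<close>

lemma schur_complex:
  fixes A :: "complex mat"
  assumes "A \<in> carrier_mat n n"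
  obtains U P Q where "similar_mat_wit A U P Q" "upper_triangular U"
proof -
  obtain es where es: "char_poly A = (\<Prod>e\<leftarrow>es. [:- e, 1:])"
    using char_poly_factorized[OF assms] by blast
  obtain U P Q where "schur_decomposition A es = (U, P, Q)" by (cases "schur_decomposition A es")
  then show ?thesis using that schur_decomposition[OF assms es] by blast
qed

lemma proots_linear_factors:
  fixes xs :: "'a::idom list"
  shows "proots (\<Prod>x\<leftarrow>xs. [:- x, 1:]) = mset xs"
proof (induction xs)
  case (Cons x xs)
  have "(\<Prod>x\<leftarrow>xs. [:- x, 1:]) \<noteq> 0" by (auto simp: prod_list_zero_iff)
  then have "proots ([:- x, 1:] * (\<Prod>x\<leftarrow>xs. [:- x, 1:])) = mset (x # xs)"
    by (subst proots_mult) (auto simp: Cons.IH)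
  then show ?case by simp
qed simp

text \<open>Similarity preserves the characteristic polynomial, and that of a triangular matrix is
  the product of linear factors over its diagonal.\<close>

lemma proots_char_poly_triangularized:
  fixes A :: "'a::idom mat"
  assumes "similar_mat_wit A U P Q" "upper_triangular U"
  shows "proots (char_poly A) = mset (diag_mat U)"
proof -
  obtain n where "U \<in> carrier_mat n n" using similar_mat_witD[OF refl assms(1)] by blast
  moreover have "similar_mat A U" using assms(1) unfolding similar_mat_def by blast
  ultimately have "char_poly A = (\<Prod>a\<leftarrow>diag_mat U. [:- a, 1:])"
    using char_poly_similar char_poly_upper_triangular assms(2) by metis
  also have "proots \<dots> = mset (diag_mat U)"
    by (rule proots_linear_factors)
  finally show ?thesis .
qed

text \<open>Constant row sums make the all-ones vector an eigenvector for \<open>s\<close>. Taking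
  it as first basis vector splits off \<open>s\<close> (deflation), and a Schur decomposition of the
  remaining \<open>p\<close> by \<open>p\<close> block does not disturb that vector.\<close>

lemma schur_constant_row_sum:
  fixes B :: "complex mat"
  assumes B: "B \<in> carrier_mat (Suc p) (Suc p)"
    and sum: "\<And>i. i < Suc p \<Longrightarrow> (\<Sum>j<Suc p. B $$ (i, j)) = s"
  obtains U P Q where "similar_mat_wit B U P Q" "upper_triangular U" "U $$ (0, 0) = s"
    "\<And>i. i < Suc p \<Longrightarrow> P $$ (i, 0) = 1"
proof -
  obtain b00 b01 b10 b11 where sp: "split_block B 1 1 = (b00, b01, b10, b11)"
    by (cases "split_block B 1 1")
  have blk: "b00 \<in> carrier_mat 1 1" "b01 \<in> carrier_mat 1 p" "b10 \<in> carrier_mat p 1"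
    "b11 \<in> carrier_mat p p" and Bb: "B = four_block_mat b00 b01 b10 b11"
    using split_block[OF sp, of p p] B by auto
  define o1 :: "complex mat" where "o1 = mat p 1 (\<lambda>_. 1)"
  have o1: "o1 \<in> carrier_mat p 1" unfolding o1_def by simp
  \<comment> \<open>The columns of \<open>S\<close> are the all-ones vector followed by the standard
    basis vectors except the first. Its inverse \<open>S'\<close> has the same shape with
    \<open>o1\<close> negated.\<close>
  define S :: "complex mat" where "S = four_block_mat (1\<^sub>m 1) (0\<^sub>m 1 p) o1 (1\<^sub>m p)"
  define S' :: "complex mat" where "S' = four_block_mat (1\<^sub>m 1) (0\<^sub>m 1 p) (- o1) (1\<^sub>m p)"
  have SS: "S * S' = 1\<^sub>m (Suc p)" "S' * S = 1\<^sub>m (Suc p)"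
  proof -
    have z: "1\<^sub>m 1 * 1\<^sub>m 1 + 0\<^sub>m 1 p * X = 1\<^sub>m 1"
      "1\<^sub>m 1 * 0\<^sub>m 1 p + 0\<^sub>m 1 p * 1\<^sub>m p = (0\<^sub>m 1 p :: complex mat)"
      "X * 0\<^sub>m 1 p + 1\<^sub>m p * 1\<^sub>m p = 1\<^sub>m p"
      "X * 1\<^sub>m 1 + 1\<^sub>m p * - X = 0\<^sub>m p 1"
      if "X \<in> carrier_mat p 1" for X :: "complex mat"
      using that by auto
    \<comment> \<open>One identity for all \<open>X\<close>: taken at \<open>o1\<close> and at
      \<open>- o1\<close> it gives both orders of the product.\<close>
    have inv: "four_block_mat (1\<^sub>m 1) (0\<^sub>m 1 p) X (1\<^sub>m p) *
        four_block_mat (1\<^sub>m 1) (0\<^sub>m 1 p) (- X) (1\<^sub>m p) = 1\<^sub>m (Suc p)"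
      if X: "X \<in> carrier_mat p 1" for X :: "complex mat"
    proof -
      have mX: "- X \<in> carrier_mat p 1" using X by simp
      show ?thesis
        unfolding mult_four_block_mat[OF one_carrier_mat zero_carrier_mat X one_carrier_mat
            one_carrier_mat zero_carrier_mat mX one_carrier_mat] z[OF X] z[OF mX]
          four_block_one_mat by simp
    qed
    have "- o1 \<in> carrier_mat p 1" "- (- o1) = o1" using o1 by auto
    then show "S * S' = 1\<^sub>m (Suc p)" "S' * S = 1\<^sub>m (Suc p)"
      unfolding S_def S'_def using inv[OF o1] inv[of "- o1"] by simp_all
  qed
  have S: "S \<in> carrier_mat (Suc p) (Suc p)" "S' \<in> carrier_mat (Suc p) (Suc p)"
    unfolding S_def S'_def using o1 by auto
  \<comment> \<open>The lower right block of \<open>B\<close> in the new basis, found by solving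
    \<open>o1 * b01 + D = b11\<close>, which is the corresponding block of the equation
    \<open>BS\<close> below.\<close>
  define D where "D = b11 - o1 * b01"
  have D: "D \<in> carrier_mat p p" unfolding D_def using blk o1 by auto
  define L :: "complex mat" where "L = mat 1 1 (\<lambda>_. s)"
  have L: "L \<in> carrier_mat 1 1" unfolding L_def by simp
  have BS: "B * S = S * four_block_mat L b01 (0\<^sub>m p 1) D"
  proof -
    have "b00 * 1\<^sub>m 1 + b01 * o1 = L"
    proof (rule eq_matI)
      fix i j assume "i < dim_row L" "j < dim_col L"
      then have [simp]: "i = 0" "j = 0" using L by auto
      have "s = (\<Sum>j<Suc p. B $$ (0, j))" using sum[of 0] by simp
      also have "\<dots> = B $$ (0, 0) + (\<Sum>j<p. B $$ (0, Suc j))"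
        by (rule sum.lessThan_Suc_shift)
      also have "\<dots> = (b00 * 1\<^sub>m 1 + b01 * o1) $$ (0, 0)"
        using blk by (auto simp: Bb o1_def scalar_prod_def atLeast0LessThan)
      finally show "(b00 * 1\<^sub>m 1 + b01 * o1) $$ (i, j) = L $$ (i, j)"
        by (simp add: L_def)
    qed (use blk o1 L in auto)
    moreover have "b10 * 1\<^sub>m 1 + b11 * o1 = o1 * L"
    proof (rule eq_matI)
      fix i j assume "i < dim_row (o1 * L)" "j < dim_col (o1 * L)"
      then have ij [simp]: "i < p" "j = 0" using L o1 by auto
      have "s = (\<Sum>j<Suc p. B $$ (Suc i, j))" using sum[of "Suc i"] by simp
      also have "\<dots> = B $$ (Suc i, 0) + (\<Sum>j<p. B $$ (Suc i, Suc j))"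
        by (rule sum.lessThan_Suc_shift)
      also have "\<dots> = (b10 * 1\<^sub>m 1 + b11 * o1) $$ (i, 0)"
        using blk ij by (auto simp: Bb o1_def scalar_prod_def atLeast0LessThan)
      finally show "(b10 * 1\<^sub>m 1 + b11 * o1) $$ (i, j) = (o1 * L) $$ (i, j)"
        by (simp add: L_def o1_def scalar_prod_def)
    qed (use blk o1 L in auto)
    moreover have "o1 * b01 + D = b11"
      unfolding D_def using blk o1 by (intro eq_matI) auto
    ultimately show ?thesis
      unfolding Bb S_def mult_four_block_mat[OF blk one_carrier_mat zero_carrier_mat o1 one_carrier_mat]
        mult_four_block_mat[OF one_carrier_mat zero_carrier_mat o1 one_carrier_mat
          L blk(2) zero_carrier_mat D]
      using blk o1 L D by simp
  qed
  have F: "four_block_mat L b01 (0\<^sub>m p 1) D \<in> carrier_mat (Suc p) (Suc p)"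
    using L D blk by auto
  have 1: "similar_mat_wit B (four_block_mat L b01 (0\<^sub>m p 1) D) S S'"
  proof (rule similar_mat_witI[OF SS _ B F S])
    have "B = B * (S * S')" using B by (simp add: SS)
    also have "\<dots> = B * S * S'" using B S by simp
    finally show "B = S * four_block_mat L b01 (0\<^sub>m p 1) D * S'" by (simp add: BS)
  qed
  obtain V P Q where V: "similar_mat_wit D V P Q" "upper_triangular V"
    using schur_complex[OF D] .
  note VD = similar_mat_witD2[OF D V(1)]
  define U where "U = four_block_mat L (b01 * P) (0\<^sub>m p 1) V"
  \<comment> \<open>\<open>T\<close> fixes the first basis vector, so the first column of
    \<open>S * T\<close> is still the all-ones column of \<open>S\<close>.\<close>
  define T where "T = four_block_mat (1\<^sub>m 1) (0\<^sub>m 1 p) (0\<^sub>m p 1) P"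
  define T' where "T' = four_block_mat (1\<^sub>m 1) (0\<^sub>m 1 p) (0\<^sub>m p 1) Q"
  have "b01 = 1\<^sub>m 1 * (b01 * P) * Q"
  proof -
    have "b01 = b01 * (P * Q)" using blk VD by simp
    also have "\<dots> = b01 * P * Q" using blk VD by simp
    also have "\<dots> = 1\<^sub>m 1 * (b01 * P) * Q" using blk VD by simp
    finally show ?thesis .
  qed
  then have 2: "similar_mat_wit (four_block_mat L b01 (0\<^sub>m p 1) D) U T T'"
    unfolding U_def T_def T'_def
    by (intro similar_mat_wit_four_block[OF similar_mat_wit_refl[OF L] V(1) _ _ L D])
       (use blk VD in auto)
  have "similar_mat_wit B U (S * T) (T' * S')" by (rule similar_mat_wit_trans[OF 1 2])
  moreover have "upper_triangular U"
    unfolding U_def using L VD V(2) by (auto simp: upper_triangular_def)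
  moreover have "U $$ (0, 0) = s" unfolding U_def using L VD by (auto simp: L_def)
  moreover have "(S * T) $$ (i, 0) = 1" if "i < Suc p" for i
  proof -
    have "S * T = four_block_mat (1\<^sub>m 1) (0\<^sub>m 1 p) o1 P"
      unfolding S_def T_def using o1 VD
      by (subst mult_four_block_mat[OF one_carrier_mat zero_carrier_mat o1 one_carrier_mat
          one_carrier_mat zero_carrier_mat zero_carrier_mat VD(6)]) simp
    then show ?thesis using that o1 VD by (auto simp: o1_def)
  qed
  ultimately show ?thesis using that by blast
qed

section \<open>Row sums and the Perron eigenvalue\<close>

text \<open>The all-ones vector shows that \<open>s\<close> is an eigenvalue. Conversely, the
  eigenvalue equation of any eigenvector, read at a coordinate of largest modulus, bounds the
  eigenvalue by that row's sum.\<close>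

lemma spectral_radius_constant_row_sum:
  assumes A: "A \<in> carrier_mat n n" and n: "n > 0" and nonneg: "nonnegative_mat A"
    and sum: "\<And>i. i < n \<Longrightarrow> (\<Sum>j<n. A $$ (i, j)) = s"
  shows "spectral_radius (complex_mat A) = s"
proof (rule antisym)
  let ?A = "complex_mat A"
  have CA: "?A \<in> carrier_mat n n" using A by simp
  have A0: "A $$ (i, j) \<ge> 0" if "i < n" "j < n" for i j
    using nonneg that A unfolding nonnegative_mat_def by auto
  have mult: "(?A *\<^sub>v v) $ i = (\<Sum>j<n. of_real (A $$ (i, j)) * v $ j)"
    if "i < n" "v \<in> carrier_vec n" for v i
    using that A by (auto simp: scalar_prod_def atLeast0LessThan)
  let ?v = "vec n (\<lambda>_. 1 :: complex)"
  have "eigenvector ?A ?v (of_real s)"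
    unfolding eigenvector_def
  proof (intro conjI)
    show "?v \<noteq> 0\<^sub>v (dim_row ?A)"
    proof
      assume "?v = (0\<^sub>v (dim_row ?A) :: complex vec)"
      from arg_cong[OF this, of "\<lambda>v. v $ 0"] show False using n A by auto
    qed
    show "?A *\<^sub>v ?v = of_real s \<cdot>\<^sub>v ?v"
    proof (rule eq_vecI)
      fix i assume "i < dim_vec (complex_of_real s \<cdot>\<^sub>v ?v)"
      then have i: "i < n" by simp
      show "(?A *\<^sub>v ?v) $ i = (complex_of_real s \<cdot>\<^sub>v ?v) $ i"
        using i sum[OF i] by (simp add: mult flip: of_real_sum)
    qed (use A in auto)
  qed (use A in auto)
  then have "complex_of_real s \<in> spectrum ?A"
    unfolding spectrum_def eigenvalue_def by blast
  then have "norm (complex_of_real s) \<le> spectral_radius ?A"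
    using spectral_radius_mem_max(2)[OF CA n] by blast
  then show "s \<le> spectral_radius ?A" by simp
  obtain \<mu> where \<mu>: "\<mu> \<in> spectrum ?A" "spectral_radius ?A = norm \<mu>"
    using spectral_radius_mem_max(1)[OF CA n] by blast
  then obtain v where "eigenvector ?A v \<mu>" unfolding spectrum_def eigenvalue_def by blast
  then have v: "v \<in> carrier_vec n" "v \<noteq> 0\<^sub>v n" "?A *\<^sub>v v = \<mu> \<cdot>\<^sub>v v"
    using A unfolding eigenvector_def by auto
  let ?N = "(\<lambda>i. norm (v $ i)) ` {..<n}"
  have "Max ?N \<in> ?N" using n by (intro Max_in) auto
  then obtain k where k: "k < n" "norm (v $ k) = Max ?N" by auto
  have le: "norm (v $ j) \<le> norm (v $ k)" if "j < n" for j
    unfolding k(2) using that by (intro Max_ge) auto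
  \<comment> \<open>Needed to divide the final estimate by the largest modulus.\<close>
  have pos: "norm (v $ k) > 0"
  proof (rule ccontr)
    assume "\<not> ?thesis"
    then have "v $ j = 0" if "j < n" for j using le[OF that] by simp
    then have "v = 0\<^sub>v n" using v(1) by (intro eq_vecI) auto
    then show False using v(2) by simp
  qed
  have "norm \<mu> * norm (v $ k) = norm ((?A *\<^sub>v v) $ k)"
    using v k by (simp add: norm_mult)
  also have "\<dots> \<le> (\<Sum>j<n. norm (of_real (A $$ (k, j)) * v $ j))"
    unfolding mult[OF k(1) v(1)] by (rule norm_sum)
  also have "\<dots> \<le> (\<Sum>j<n. A $$ (k, j) * norm (v $ k))"
    using A0 k le by (intro sum_mono) (auto simp: norm_mult intro!: mult_mono)
  also have "\<dots> = s * norm (v $ k)" using sum[OF k(1)] by (simp flip: sum_distrib_right)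
  finally show "spectral_radius ?A \<le> s" using pos \<mu>(2) by simp
qed

lemma permutative_mat_iff:
  assumes "A \<in> carrier_mat n n"
  shows "permutative_mat A \<longleftrightarrow> (\<forall>i<n. (\<Sum>j<n. {#A $$ (i, j)#}) = (\<Sum>j<n. {#A $$ (0, j)#}))"
proof -
  have "mset (list_of_vec (row A i)) = (\<Sum>j<n. {#A $$ (i, j)#})" if "i < n" for i
    using assms that by (auto simp: mset_list_of_vec)
  then show ?thesis using assms unfolding permutative_mat_def
    \<comment> \<open>For \<open>n = 0\<close> there is no row \<open>0\<close>, but then both
      conditions are vacuous.\<close>
    by (cases "n = 0") auto
qed

text \<open>All rows have the sum of row \<open>0\<close>, and for a nonnegative matrix a common row
  sum is the spectral radius.\<close>

lemma permutative_nonnegative_row_sum: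
  assumes A: "A \<in> carrier_mat n n" and "permutative_mat A" "nonnegative_mat A" "i < n"
  shows "(\<Sum>j<n. A $$ (i, j)) = perron_eigenvalue A"
proof -
  have *: "(\<Sum>j<n. A $$ (k, j)) = (\<Sum>j<n. A $$ (0, j))" if "k < n" for k
    using that assms(2) unfolding permutative_mat_iff[OF A] by (blast intro: sum_singleton_eq_sum[where n=n and m=n])
  have "perron_eigenvalue A = (\<Sum>j<n. A $$ (0, j))"
    unfolding perron_eigenvalue_def
  proof (rule spectral_radius_constant_row_sum[OF A _ assms(3)])
    show "n > 0" using assms(4) by simp
  qed (rule *)
  then show ?thesis using *[OF assms(4)] by simp
qed

section \<open>Multiplicities, and the glued matrix with its spectrum\<close>

lemma sum_const_mset: "(\<Sum>x\<in>S. M) = repeat_mset (card S) M"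
  by (induction S rule: infinite_finite_induct) auto

lemma image_repeat_mset: "image_mset f (repeat_mset n M) = repeat_mset n (image_mset f M)"
  by (induction n) auto

text \<open>Defined over any unital ring, so that the same formula serves for the real matrices and
  for their complex images.\<close>

definition kron_glue :: "'a::ring_1 \<Rightarrow> 'a mat \<Rightarrow> 'a mat \<Rightarrow> 'a mat" where
  "kron_glue s A B = kron (1\<^sub>m (dim_row A)) B + kron (A - s \<cdot>\<^sub>m 1\<^sub>m (dim_row A))
     (mat (dim_row B) (dim_row B) (\<lambda>(i, j). if j = 0 then 1 else 0))"

lemma kron_glue_carrier:
  assumes "A \<in> carrier_mat r r" "B \<in> carrier_mat m m"
  shows "kron_glue s A B \<in> carrier_mat (r * m) (r * m)"
  using assms unfolding kron_glue_def by (auto simp: kron_def)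

text \<open>The diagonal hypothesis makes the diagonal of \<open>A - s I\<close> zero, so diagonal
  blocks see only \<open>B\<close>; off the diagonal only the column of ones survives.\<close>

lemma index_kron_glue:
  fixes A B :: "'a::ring_1 mat"
  assumes A: "A \<in> carrier_mat r r" and B: "B \<in> carrier_mat m m"
    and diag: "\<And>i. i < r \<Longrightarrow> A $$ (i, i) = s" and kl: "k < r * m" "l < r * m"
  shows "kron_glue s A B $$ (k, l) = (if k div m = l div m then B $$ (k mod m, l mod m)
    else if l mod m = 0 then A $$ (k div m, l div m) else 0)"
proof -
  note l = div_mod_less[OF kl(1)] div_mod_less[OF kl(2)]
  let ?C = "mat m m (\<lambda>(i, j). if j = 0 then 1 else 0)"
  have A0: "A - s \<cdot>\<^sub>m 1\<^sub>m r \<in> carrier_mat r r"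
    by (intro minus_carrier_mat smult_carrier_mat one_carrier_mat)
  have "kron_glue s A B $$ (k, l) = kron (1\<^sub>m r) B $$ (k, l) + kron (A - s \<cdot>\<^sub>m 1\<^sub>m r) ?C $$ (k, l)"
    unfolding kron_glue_def using kl carrier_matD[OF A] carrier_matD[OF B]
      carrier_matD[OF kron_carrier[OF A0 mat_carrier[of m m]]] by auto
  also have "\<dots> = (1\<^sub>m r) $$ (k div m, l div m) * B $$ (k mod m, l mod m) +
      (A - s \<cdot>\<^sub>m 1\<^sub>m r) $$ (k div m, l div m) * ?C $$ (k mod m, l mod m)"
    by (simp only: index_kron[OF one_carrier_mat B kl] index_kron[OF A0 mat_carrier kl])
  finally show ?thesis using l diag by auto
qed

text \<open>Each block on the diagonal of the triangular form trades one \<open>s\<close> for an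
  eigenvalue of \<open>A\<close>. Adding \<open>r\<close> copies of \<open>s\<close> on the left
  expresses this without multiset subtraction.\<close>

lemma proots_char_poly_kron_glue:
  fixes A B :: "complex mat"
  assumes A: "A \<in> carrier_mat r r" and B: "B \<in> carrier_mat (Suc p) (Suc p)"
    and sum: "\<And>i. i < Suc p \<Longrightarrow> (\<Sum>j<Suc p. B $$ (i, j)) = s"
  shows "proots (char_poly (kron_glue s A B)) + repeat_mset r {#s#} =
    proots (char_poly A) + repeat_mset r (proots (char_poly B))"
proof -
  obtain V R R' where V: "similar_mat_wit A V R R'" "upper_triangular V"
    using schur_complex[OF A] .
  obtain U T T' where U: "similar_mat_wit B U T T'" "upper_triangular U" "U $$ (0, 0) = s"
    and T0: "\<And>i. i < Suc p \<Longrightarrow> T $$ (i, 0) = 1"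
    by (rule schur_constant_row_sum[OF B sum]) blast+
  note VD = similar_mat_witD2[OF A V(1)]
  note UD = similar_mat_witD2[OF B U(1)]
  define A0 where "A0 = A - s \<cdot>\<^sub>m 1\<^sub>m r"
  define V0 where "V0 = V - s \<cdot>\<^sub>m 1\<^sub>m r"
  have A0: "A0 \<in> carrier_mat r r" and V0: "V0 \<in> carrier_mat r r"
    unfolding A0_def V0_def using A VD by auto
  define C :: "complex mat" where "C = mat (Suc p) (Suc p) (\<lambda>(i, j). if j = 0 then 1 else 0)"
  have C: "C \<in> carrier_mat (Suc p) (Suc p)" unfolding C_def by simp
  define C' where "C' = T' * C * T"
  have C': "C' \<in> carrier_mat (Suc p) (Suc p)" unfolding C'_def using C UD by simp
  \<comment> \<open>All rows of \<open>C * T\<close> equal row \<open>0\<close> of \<open>T\<close>,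
    so an entry of \<open>C'\<close> is a row sum of \<open>T'\<close> times an entry of that
    row.\<close>
  have C'_index: "C' $$ (i, j) = (if i = 0 then T $$ (0, j) else 0)" if "i < Suc p" "j < Suc p" for i j
  proof -
    have CT: "(C * T) $$ (k, j) = T $$ (0, j)" if "k < Suc p" for k
    proof -
      have "(C * T) $$ (k, j) = (\<Sum>l<Suc p. (if l = 0 then 1 else 0) * T $$ (l, j))"
        using that \<open>j < Suc p\<close> C UD by (auto simp: C_def scalar_prod_def atLeast0LessThan simp del: sum.lessThan_Suc)
      also have "\<dots> = T $$ (0, j)" by (subst sum.lessThan_Suc_shift) simp
      finally show ?thesis .
    qed
    \<comment> \<open>Column \<open>0\<close> of \<open>T\<close> is all ones, so column
      \<open>0\<close> of \<open>T' * T = 1\<close> lists the row sums of \<open>T'\<close>.\<close>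
    have "(T' * T) $$ (i, 0) = (\<Sum>k<Suc p. T' $$ (i, k) * T $$ (k, 0))"
      using that UD(6,7) by (auto simp: scalar_prod_def atLeast0LessThan simp del: sum.lessThan_Suc)
    also have "\<dots> = (\<Sum>k<Suc p. T' $$ (i, k))" using T0 by (intro sum.cong) auto
    finally have T'_sum: "(\<Sum>k<Suc p. T' $$ (i, k)) = (if i = 0 then 1 else 0)"
      using that UD(2) by simp
    have "C' = T' * (C * T)" unfolding C'_def using C UD by (intro assoc_mult_mat) auto
    then have "C' $$ (i, j) = (\<Sum>k<Suc p. T' $$ (i, k) * (C * T) $$ (k, j))"
      using that UD(6,7) C by (auto simp: scalar_prod_def atLeast0LessThan simp del: sum.lessThan_Suc)
    also have "\<dots> = (\<Sum>k<Suc p. T' $$ (i, k) * T $$ (0, j))"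
      using CT by (intro sum.cong) auto
    also have "\<dots> = (if i = 0 then T $$ (0, j) else 0)"
      unfolding sum_distrib_right[symmetric] T'_sum by simp
    finally show ?thesis .
  qed
  let ?n = "r * Suc p"
  have M: "kron_glue s A B = kron (1\<^sub>m r) B + kron A0 C"
    unfolding kron_glue_def A0_def C_def using A B by simp
  let ?M = "kron (1\<^sub>m r) B + kron A0 C"
  \<comment> \<open>The result of conjugating by \<open>kron R T\<close>: \<open>U\<close> and
    \<open>C'\<close> replace \<open>B\<close> and \<open>C\<close>, while \<open>V0\<close>
    replaces \<open>A0\<close> because the shift by \<open>s\<close> commutes with
    conjugation.\<close>
  define W where "W = kron (1\<^sub>m r) U + kron V0 C'"
  have W_index: "W $$ (i, j) = (if i div Suc p = j div Suc p then U $$ (i mod Suc p, j mod Suc p) else 0)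
      + V0 $$ (i div Suc p, j div Suc p) * C' $$ (i mod Suc p, j mod Suc p)"
    if "i < ?n" "j < ?n" for i j
    unfolding W_def using that div_mod_less[OF that(1)] div_mod_less[OF that(2)] V0 C' UD
      kron_carrier[OF V0 C'] kron_carrier[OF one_carrier_mat[of r] UD(5)]
    by (auto simp: index_kron[OF one_carrier_mat UD(5)] index_kron[OF V0 C'])
  have "similar_mat_wit ?M W (kron R T) (kron R' T')"
  proof (rule similar_mat_witI)
    show "kron R T * kron R' T' = 1\<^sub>m ?n" "kron R' T' * kron R T = 1\<^sub>m ?n"
      by (simp_all only: kron_mult[OF VD(6,7) UD(6,7)] kron_mult[OF VD(7,6) UD(7,6)] VD(1,2) UD(1,2)
          kron_one)
    show "?M \<in> carrier_mat ?n ?n" and W: "W \<in> carrier_mat ?n ?n"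
      and K: "kron R T \<in> carrier_mat ?n ?n" "kron R' T' \<in> carrier_mat ?n ?n"
      unfolding W_def using A0 C B VD UD V0 C' by (auto simp del: mult_Suc_right)
    have K1: "kron (1\<^sub>m r) U \<in> carrier_mat ?n ?n" and K2: "kron V0 C' \<in> carrier_mat ?n ?n"
      using UD V0 C' by (auto simp del: mult_Suc_right)
    have RV: "R * V0 * R' = A0"
    proof -
      have "R * V0 = R * V - R * (s \<cdot>\<^sub>m 1\<^sub>m r)"
        unfolding V0_def using VD by (intro mult_minus_distrib_mat) auto
      also have "R * (s \<cdot>\<^sub>m 1\<^sub>m r) = s \<cdot>\<^sub>m R"
        using VD by (subst mult_smult_distrib[of _ r r]) auto
      finally have "R * V0 * R' = R * V * R' - s \<cdot>\<^sub>m R * R'"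
        using VD by (simp add: minus_mult_distrib_mat[of _ r r])
      also have "s \<cdot>\<^sub>m R * R' = s \<cdot>\<^sub>m (R * R')"
        using VD by (intro mult_smult_assoc_mat) auto
      finally show ?thesis unfolding A0_def using VD(1,3) by simp
    qed
    have "T * C' = (T * T') * (C * T)"
      unfolding C'_def assoc_mult_mat[OF UD(7) C UD(6)]
      using assoc_mult_mat[OF UD(6,7) mult_carrier_mat[OF C UD(6)]] by simp
    then have "T * C' * T' = C * T * T'" using C UD(1,6) by simp
    also have "\<dots> = C * (T * T')" using C UD(6,7) by (intro assoc_mult_mat) auto
    finally have TC: "T * C' * T' = C" using C UD(1) by simp
    have "kron R T * W * kron R' T' = kron R T * kron (1\<^sub>m r) U * kron R' T' + kron R T * kron V0 C' * kron R' T'"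
      unfolding W_def using K K1 K2
      by (simp add: mult_add_distrib_mat[of _ ?n ?n] add_mult_distrib_mat[of _ ?n ?n])
    also have "kron R T * kron (1\<^sub>m r) U = kron R (T * U)"
      using VD UD by (simp add: kron_mult[OF VD(6) one_carrier_mat UD(6,5)])
    also have "kron R (T * U) * kron R' T' = kron (1\<^sub>m r) B"
      using VD UD by (simp add: kron_mult[OF VD(6,7) mult_carrier_mat[OF UD(6,5)] UD(7)])
    also have "kron R T * kron V0 C' * kron R' T' = kron A0 C"
      by (simp only: kron_mult[OF VD(6) V0 UD(6) C'] RV TC
          kron_mult[OF mult_carrier_mat[OF VD(6) V0] VD(7) mult_carrier_mat[OF UD(6) C'] UD(7)])
    finally show "?M = kron R T * W * kron R' T'" by simp
  qed
  moreover have W: "W \<in> carrier_mat ?n ?n" unfolding W_def using V0 C' UD by (auto simp del: mult_Suc_right)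
  have "upper_triangular W"
  proof (rule upper_triangularI)
    fix i j assume ji: "j < i" and "i < dim_row W"
    then have i: "i < ?n" and j: "j < ?n" using W by auto
    note l = div_mod_less[OF i] div_mod_less[OF j]
    have "j div Suc p \<le> i div Suc p" using ji by (intro div_le_mono) simp
    then consider "j div Suc p < i div Suc p" | "j div Suc p = i div Suc p" by linarith
    then show "W $$ (i, j) = 0"
    proof cases
      case 1
      then have "V0 $$ (i div Suc p, j div Suc p) = 0"
        unfolding V0_def using l VD(5) V(2) by auto
      then show ?thesis using 1 by (simp add: W_index[OF i j])
    next
      case 2
      \<comment> \<open>Inside a diagonal block, a position below the diagonal has positive row
        index, where \<open>C'\<close> vanishes; \<open>U\<close> vanishes there by
        triangularity.\<close>
      then have "j mod Suc p < i mod Suc p"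
        using ji by (metis div_mult_mod_eq nat_add_left_cancel_less)
      then show ?thesis
        using 2 l UD(5) U(2) by (auto simp: W_index[OF i j] C'_index)
    qed
  qed
  ultimately have "proots (char_poly ?M) = mset (diag_mat W)"
    by (rule proots_char_poly_triangularized)
  also have "\<dots> = (\<Sum>k<?n. {#U $$ (k mod Suc p, k mod Suc p) +
      V0 $$ (k div Suc p, k div Suc p) * C' $$ (k mod Suc p, k mod Suc p)#})"
    using W by (auto simp: mset_diag_mat W_index simp del: mult_Suc_right intro!: sum.cong)
  also have "\<dots> = (\<Sum>i<r. \<Sum>b<Suc p. {#U $$ (b, b) + V0 $$ (i, i) * C' $$ (b, b)#})"
    by (rule sum_lessThan_mult)
  \<comment> \<open>In block \<open>i\<close> the first diagonal entry is
    \<open>s + (V $$ (i, i) - s) * 1\<close>, since \<open>T $$ (0, 0) = 1\<close>; the later ones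
    are those of \<open>U\<close>, as \<open>C'\<close> lives in row \<open>0\<close>.\<close>
  also have "\<dots> = (\<Sum>i<r. {#V $$ (i, i)#} + (\<Sum>b<p. {#U $$ (Suc b, Suc b)#}))"
  proof (rule sum.cong[OF refl])
    fix i assume "i \<in> {..<r}"
    then have "V0 $$ (i, i) = V $$ (i, i) - s" unfolding V0_def using VD by auto
    then show "(\<Sum>b<Suc p. {#U $$ (b, b) + V0 $$ (i, i) * C' $$ (b, b)#}) =
        {#V $$ (i, i)#} + (\<Sum>b<p. {#U $$ (Suc b, Suc b)#})"
      by (subst sum.lessThan_Suc_shift) (simp add: C'_index T0 U(3))
  qed
  also have "\<dots> = mset (diag_mat V) + repeat_mset r (\<Sum>b<p. {#U $$ (Suc b, Suc b)#})"
    unfolding sum.distrib sum_const_mset using VD(5) by (simp add: mset_diag_mat)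
  finally have "proots (char_poly ?M) + repeat_mset r {#s#} =
      mset (diag_mat V) + repeat_mset r ({#s#} + (\<Sum>b<p. {#U $$ (Suc b, Suc b)#}))"
    by (simp add: repeat_mset_distrib2 del: add_mset_add_single)
  also have "{#s#} + (\<Sum>b<p. {#U $$ (Suc b, Suc b)#}) = mset (diag_mat U)"
    using carrier_matD(1)[OF UD(5)] unfolding mset_diag_mat
    by (simp only: sum.lessThan_Suc_shift U(3))
  finally show ?thesis
    unfolding M using proots_char_poly_triangularized[OF V] proots_char_poly_triangularized[OF U(1,2)]
    by simp
qed

section \<open>Permutativity, nonnegativity and spectrum of the glued real matrix\<close>

theorem theorem2p3:
  fixes \<Lambda> \<Lambda>0 \<Lambda>1 :: "real list" and lam :: real and n r p :: nat
  assumes "n \<ge> 1" and "length \<Lambda> = n"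
    and "length \<Lambda>0 = r" and "length \<Lambda>1 = p"
    and "mset \<Lambda> = mset \<Lambda>0 + repeat_mset r (mset \<Lambda>1)"
    and "0 \<le> lam" and "lam \<le> \<Lambda> ! 0"
    and "\<exists>B \<in> carrier_mat (p + 1) (p + 1). permutative_mat B \<and> nonnegative_mat B \<and>
           has_spectrum B (lam # \<Lambda>1) \<and> perron_eigenvalue B = lam"
    and "\<exists>A \<in> carrier_mat r r. permutative_mat A \<and> nonnegative_mat A \<and>
           has_spectrum A \<Lambda>0 \<and> (\<forall>i < r. A $$ (i, i) = lam)"
  shows "\<exists>P \<in> carrier_mat n n. permutative_mat P \<and> nonnegative_mat P \<and> has_spectrum P \<Lambda>"
proof -
  obtain B where B: "B \<in> carrier_mat (Suc p) (Suc p)" "permutative_mat B" "nonnegative_mat B"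
    "has_spectrum B (lam # \<Lambda>1)" "perron_eigenvalue B = lam" using assms(8) by auto
  obtain A where A: "A \<in> carrier_mat r r" "permutative_mat A" "nonnegative_mat A"
    "has_spectrum A \<Lambda>0" "\<And>i. i < r \<Longrightarrow> A $$ (i, i) = lam" using assms(9) by auto
  \<comment> \<open>Counting elements in the partition gives \<open>n = r + r * p\<close>.\<close>
  have n: "n = r * Suc p"
    using arg_cong[OF assms(5), of size] assms(2-4) by simp
  define P where "P = kron_glue lam A B"
  have P: "P \<in> carrier_mat n n" unfolding P_def n by (rule kron_glue_carrier[OF A(1) B(1)])
  \<comment> \<open>\<open>(i, j)\<close> names the block and \<open>(b, c)\<close> the position in
    it, the form in which \<open>sum_lessThan_mult\<close> splits a row sum.\<close>
  define F where "F i b j c = (if i = j then B $$ (b, c) else if c = 0 then A $$ (i, j) else 0)"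
    for i b j c
  have P_index: "P $$ (k, l) = F (k div Suc p) (k mod Suc p) (l div Suc p) (l mod Suc p)"
    if "k < n" "l < n" for k l
    unfolding P_def F_def using that n by (intro index_kron_glue[OF A(1) B(1) A(5)]) auto
  have "permutative_mat P"
  proof -
    \<comment> \<open>A row of \<open>P\<close> lacks the diagonal entry \<open>lam\<close> of the
      row of \<open>A\<close>. Adding it completes that row, and the right-hand side no longer
      depends on \<open>k\<close>.\<close>
    have row: "(\<Sum>l<n. {#P $$ (k, l)#}) + {#lam#} =
      (\<Sum>c<Suc p. {#B $$ (0, c)#}) + (\<Sum>j<r. {#A $$ (0, j)#}) + repeat_mset ((r - 1) * p) {#0#}"
      if k: "k < n" for k
    proof -
      define i b where ib: "i = k div Suc p" "b = k mod Suc p"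
      have i: "i < r" and b: "b < Suc p" using div_mod_less[of k r "Suc p"] k n ib by auto
      have off: "(\<Sum>c<Suc p. {#F i b j c#}) = {#A $$ (i, j)#} + repeat_mset p {#0#}"
        if "i \<noteq> j" for j
        using that by (subst sum.lessThan_Suc_shift) (simp add: F_def sum_const_mset)
      have "(\<Sum>l<n. {#P $$ (k, l)#}) = (\<Sum>l<r * Suc p. {#F i b (l div Suc p) (l mod Suc p)#})"
        using k n ib by (intro sum.cong) (auto simp: P_index)
      also have "\<dots> = (\<Sum>j<r. \<Sum>c<Suc p. {#F i b j c#})"
        by (rule sum_lessThan_mult)
      also have "\<dots> = (\<Sum>c<Suc p. {#F i b i c#}) + (\<Sum>j\<in>{..<r} - {i}. \<Sum>c<Suc p. {#F i b j c#})"
        using i by (intro sum.remove) auto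
      also have "(\<Sum>j\<in>{..<r} - {i}. \<Sum>c<Suc p. {#F i b j c#}) =
          (\<Sum>j\<in>{..<r} - {i}. {#A $$ (i, j)#}) + (\<Sum>j\<in>{..<r} - {i}. repeat_mset p {#0#})"
        unfolding sum.distrib[symmetric] by (intro sum.cong[OF refl] off) auto
      also have "(\<Sum>j\<in>{..<r} - {i}. repeat_mset p {#0::real#}) = repeat_mset ((r - 1) * p) {#0#}"
        using i by (intro multiset_eqI) (simp add: sum_const_mset)
      finally have 1: "(\<Sum>l<n. {#P $$ (k, l)#}) = (\<Sum>c<Suc p. {#B $$ (b, c)#}) +
          ((\<Sum>j\<in>{..<r} - {i}. {#A $$ (i, j)#}) + repeat_mset ((r - 1) * p) {#0#})"
        by (simp add: F_def)
      have "(\<Sum>j<r. {#A $$ (i, j)#}) = {#A $$ (i, i)#} + (\<Sum>j\<in>{..<r} - {i}. {#A $$ (i, j)#})"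
        using i by (intro sum.remove) auto
      moreover have "(\<Sum>j<r. {#A $$ (i, j)#}) = (\<Sum>j<r. {#A $$ (0, j)#})"
        using A(2) i unfolding permutative_mat_iff[OF A(1)] by blast
      ultimately have 2: "(\<Sum>j<r. {#A $$ (0, j)#}) = {#lam#} + (\<Sum>j\<in>{..<r} - {i}. {#A $$ (i, j)#})"
        using A(5)[OF i] by metis
      have 3: "(\<Sum>c<Suc p. {#B $$ (b, c)#}) = (\<Sum>c<Suc p. {#B $$ (0, c)#})"
        using B(2) b unfolding permutative_mat_iff[OF B(1)] by blast
      show ?thesis unfolding 1 2 3 by (simp only: ac_simps)
    qed
    show ?thesis unfolding permutative_mat_iff[OF P]
    proof (intro allI impI)
      fix k assume "k < n"
      then have "(\<Sum>l<n. {#P $$ (k, l)#}) + {#lam#} = (\<Sum>l<n. {#P $$ (0, l)#}) + {#lam#}"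
        using row[of k] row[of 0] by simp
      then show "(\<Sum>l<n. {#P $$ (k, l)#}) = (\<Sum>l<n. {#P $$ (0, l)#})"
        by (simp only: add_right_cancel)
    qed
  qed
  moreover have "nonnegative_mat P"
  proof -
    have "0 \<le> P $$ (k, l)" if "k < n" "l < n" for k l
    proof -
      have "k < r * Suc p" "l < r * Suc p" using that n by auto
      from div_mod_less[OF this(1)] div_mod_less[OF this(2)] show ?thesis
        using A(1,3) B(1,3) by (auto simp: P_index[OF that] F_def nonnegative_mat_def)
    qed
    then show ?thesis using P unfolding nonnegative_mat_def by auto
  qed
  moreover have "has_spectrum P \<Lambda>"
  proof -
    let ?A = "complex_mat A" and ?B = "complex_mat B"
    have cA: "?A \<in> carrier_mat r r" and cB: "?B \<in> carrier_mat (Suc p) (Suc p)"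
      using A(1) B(1) by auto
    \<comment> \<open>The spectrum lemma is about complex matrices, so gluing has to be shown to
      commute with the embedding of the reals; this is checked entrywise.\<close>
    have "complex_mat P = kron_glue (complex_of_real lam) ?A ?B" (is "_ = ?M")
    proof (rule eq_matI)
      have M: "?M \<in> carrier_mat n n" unfolding n by (rule kron_glue_carrier[OF cA cB])
      then show "dim_row (complex_mat P) = dim_row ?M" "dim_col (complex_mat P) = dim_col ?M"
        using P by auto
      fix k l assume "k < dim_row ?M" "l < dim_col ?M"
      then have kl: "k < r * Suc p" "l < r * Suc p" and "k < n" "l < n" using M n by auto
      have "?M $$ (k, l) = (if k div Suc p = l div Suc p then ?B $$ (k mod Suc p, l mod Suc p)
          else if l mod Suc p = 0 then ?A $$ (k div Suc p, l div Suc p) else 0)"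
        using A(1,5) by (intro index_kron_glue[OF cA cB _ kl]) auto
      also have "\<dots> = complex_of_real (P $$ (k, l))"
        unfolding P_index[OF \<open>k < n\<close> \<open>l < n\<close>] F_def
        using div_mod_less[OF kl(1)] div_mod_less[OF kl(2)] A(1) B(1) by auto
      finally show "complex_mat P $$ (k, l) = ?M $$ (k, l)"
        using \<open>k < n\<close> \<open>l < n\<close> P by simp
    qed
    moreover have "(\<Sum>j<Suc p. ?B $$ (i, j)) = complex_of_real lam" if "i < Suc p" for i
    proof -
      have "(\<Sum>j<Suc p. ?B $$ (i, j)) = (\<Sum>j<Suc p. complex_of_real (B $$ (i, j)))"
        using that B(1) by (intro sum.cong) auto
      also have "\<dots> = complex_of_real (\<Sum>j<Suc p. B $$ (i, j))" by (simp only: of_real_sum)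
      finally show ?thesis
        using permutative_nonnegative_row_sum[OF B(1-3) that] B(5) by (simp only:)
    qed
    ultimately have "spectrum_mset P + repeat_mset r {#complex_of_real lam#} =
        spectrum_mset A + repeat_mset r (spectrum_mset B)"
      using proots_char_poly_kron_glue[OF cA cB, of "complex_of_real lam"]
      unfolding spectrum_mset_def by (simp del: sum.lessThan_Suc)
    \<comment> \<open>The \<open>r\<close> copies of the spectrum of \<open>B\<close> contribute
      \<open>r\<close> copies of \<open>lam\<close>, which then cancel against those on the
      left.\<close>
    also have "\<dots> = image_mset complex_of_real (mset \<Lambda>) + repeat_mset r {#complex_of_real lam#}"
      using A(4) B(4) assms(5)
      by (simp add: has_spectrum_def image_repeat_mset repeat_mset_distrib2)
    finally show ?thesis unfolding has_spectrum_def by simp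
  qed
  ultimately show ?thesis using P by blast
qed

end
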